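(* Let $\mathbb{F}$ be a field and let $\mathbf{L}=\mathbf{L}_0\oplus\mathbf{W}$ be an almost Abelian Lie algebra over $\mathbb{F}$, where $\mathbf{L}_0$ is an indecomposable almost Abelian Lie algebra and $\mathbf{W}$ is a possibly trivial Abelian Lie algebra. Then the Lie orthogonal operators of $\mathbf{L}$ are $$\mathrm{LO}(\mathbf{L})=\left\{\begin{pmatrix}\phi_{00}&\phi_{01}\\ \phi_{10}&\phi_{11}\end{pmatrix}\in\mathrm{End}_{\mathbb{F}}(\mathbf{L})\;\middle|\;\phi_{00}\in\mathrm{LO}(\mathbf{L}_0),\ \phi_{01}\mathbf{W}\subset\mathcal{Z}(\mathbf{L}_0)\right\}.$$
   Context: An almost Abelian Lie algebra over a field $\mathbb{F}$ (of arbitrary, possibly infinite, dimension) is a non-Abelian Lie algebra that contains a codimension 1 Abelian subalgebra. A Lie algebra is decomposable if it is the direct sum of two commuting nonzero Lie subalgebras; otherwise it is indecomposable. Here $\mathbf{L}_0\oplus\mathbf{W}$ is the Lie algebra direct sum. $\mathcal{Z}(\cdot)$ denotes the centre. A linear operator $T\in\mathrm{End}_{\mathbb{F}}(\mathbf{L})$ is Lie orthogonal if $[TX,TY]=[X,Y]$ for all $X,Y\in\mathbf{L}$; $\mathrm{LO}(\mathbf{L})$ is the set of all Lie orthogonal operators. The block form of a linear map $\phi:\mathbf{L}\to\mathbf{L}$ is with respect to $\mathbf{L}=\mathbf{L}_0\oplus\mathbf{W}$: $\phi(X+Y)=(\phi_{00}X+\phi_{01}Y)+(\phi_{10}X+\phi_{11}Y)$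 for $X\in\mathbf{L}_0$, $Y\in\mathbf{W}$, with linear maps $\phi_{00}:\mathbf{L}_0\to\mathbf{L}_0$, $\phi_{01}:\mathbf{W}\to\mathbf{L}_0$, $\phi_{10}:\mathbf{L}_0\to\mathbf{W}$, $\phi_{11}:\mathbf{W}\to\mathbf{W}$. *)

theory Defs
  imports "HOL-Analysis.Product_Vector"
begin

section \<open>Lie algebras over an arbitrary field\<close>

text \<open>The carrier is a whole type; no finiteness of dimension is assumed.\<close>

locale lie_algebra = vector_space scale
  for scale :: "'f::field \<Rightarrow> 'a::ab_group_add \<Rightarrow> 'a" (infixr "*s" 75) +
  fixes bracket :: "'a \<Rightarrow> 'a \<Rightarrow> 'a"
  assumes bracket_add_left: "bracket (x + y) z = bracket x z + bracket y z"
    and bracket_add_right: "bracket x (y + z) = bracket x y + bracket x z"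
    and bracket_scale_left: "bracket (c *s x) y = c *s bracket x y"
    and bracket_scale_right: "bracket x (c *s y) = c *s bracket x y"
    and bracket_self: "bracket x x = 0"
    and jacobi: "bracket x (bracket y z) + bracket y (bracket z x) + bracket z (bracket x y) = 0"
begin

definition commuting :: "'a set \<Rightarrow> 'a set \<Rightarrow> bool"
  where "commuting A B \<longleftrightarrow> (\<forall>x\<in>A. \<forall>y\<in>B. bracket x y = 0)"

definition subalgebra :: "'a set \<Rightarrow> bool"
  where "subalgebra A \<longleftrightarrow> subspace A \<and> (\<forall>x\<in>A. \<forall>y\<in>A. bracket x y \<in> A)"

definition abelian_subalgebra :: "'a set \<Rightarrow> bool"
  where "abelian_subalgebra A \<longleftrightarrow> subalgebra A \<and> commuting A A"

definition center :: "'a set"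
  where "center = {z. \<forall>x. bracket z x = 0}"

definition direct_sum_of :: "'a set \<Rightarrow> 'a set \<Rightarrow> bool"
  where "direct_sum_of A B \<longleftrightarrow>
    subspace A \<and> subspace B \<and> A \<inter> B = {0} \<and> {x + y | x y. x \<in> A \<and> y \<in> B} = UNIV"

text \<open>The quotient by \<open>A\<close> is isomorphic to any linear complement of \<open>A\<close>, so codimension 1 means
  having a 1-dimensional complement. Note that \<^const>\<open>dim\<close> is 0 on infinite-dimensional
  spaces, so \<open>dim C = 1\<close> does express that \<open>C\<close> is a line.\<close>

definition codim_1 :: "'a set \<Rightarrow> bool"
  where "codim_1 A \<longleftrightarrow> (\<exists>C. direct_sum_of A C \<and> dim C = 1)"

definition decomposable :: bool
  where "decomposable \<longleftrightarrow> (\<exists>A B. subalgebra A \<and> subalgebra B \<and> A \<noteq> {0} \<and> B \<noteq> {0} \<and>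
    commuting A B \<and> direct_sum_of A B)"

definition lie_orthogonal :: "('a \<Rightarrow> 'a) set"
  where "lie_orthogonal =
    {T. Vector_Spaces.linear scale scale T \<and> (\<forall>x y. bracket (T x) (T y) = bracket x y)}"

end

locale abelian_lie_algebra = lie_algebra +
  assumes abelian: "commuting UNIV UNIV"

locale almost_abelian_lie_algebra = lie_algebra +
  assumes non_abelian: "\<not> commuting UNIV UNIV"
    and codim_1_abelian: "\<exists>A. abelian_subalgebra A \<and> codim_1 A"

locale indecomposable_almost_abelian_lie_algebra = almost_abelian_lie_algebra +
  assumes indecomposable: "\<not> decomposable"


section \<open>Direct sums of two Lie algebras\<close>

definition bracket_prod ::
    "('a \<Rightarrow> 'a \<Rightarrow> 'a) \<Rightarrow> ('b \<Rightarrow> 'b \<Rightarrow> 'b) \<Rightarrow> 'a \<times> 'b \<Rightarrow> 'a \<times> 'b \<Rightarrow> 'a \<times> 'b"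
  where "bracket_prod br1 br2 u v = (br1 (fst u) (fst v), br2 (snd u) (snd v))"

definition block_op :: "('a \<Rightarrow> 'a) \<Rightarrow> ('b \<Rightarrow> 'a) \<Rightarrow> ('a \<Rightarrow> 'b) \<Rightarrow> ('b \<Rightarrow> 'b) \<Rightarrow>
    'a::plus \<times> 'b::plus \<Rightarrow> 'a \<times> 'b"
  where "block_op \<phi>00 \<phi>01 \<phi>10 \<phi>11 = (\<lambda>(x, y). (\<phi>00 x + \<phi>01 y, \<phi>10 x + \<phi>11 y))"

locale lie_algebra_pair =
  L1: lie_algebra s1 br1 + L2: lie_algebra s2 br2
  for s1 :: "'f::field \<Rightarrow> 'a::ab_group_add \<Rightarrow> 'a" and br1
    and s2 :: "'f \<Rightarrow> 'b::ab_group_add \<Rightarrow> 'b" and br2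
begin

sublocale VP: vector_space_prod s1 s2 ..

sublocale P: lie_algebra "module_prod.scale s1 s2" "bracket_prod br1 br2"
proof
  show "bracket_prod br1 br2 x x = 0" for x
    by (simp add: bracket_prod_def zero_prod_def L1.bracket_self L2.bracket_self)
  show "bracket_prod br1 br2 x (bracket_prod br1 br2 y z) +
      bracket_prod br1 br2 y (bracket_prod br1 br2 z x) +
      bracket_prod br1 br2 z (bracket_prod br1 br2 x y) = 0" for x y z
    by (simp add: bracket_prod_def zero_prod_def L1.jacobi L2.jacobi)
qed (simp_all add: bracket_prod_def VP.scale_def
      L1.bracket_add_left L1.bracket_add_right L1.bracket_scale_left L1.bracket_scale_right
      L2.bracket_add_left L2.bracket_add_right L2.bracket_scale_left L2.bracket_scale_right)

lemma linear_block_op_iff: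
  "Vector_Spaces.linear (module_prod.scale s1 s2) (module_prod.scale s1 s2) \<phi> \<longleftrightarrow>
    (\<exists>\<phi>00 \<phi>01 \<phi>10 \<phi>11. Vector_Spaces.linear s1 s1 \<phi>00 \<and> Vector_Spaces.linear s2 s1 \<phi>01 \<and>
      Vector_Spaces.linear s1 s2 \<phi>10 \<and> Vector_Spaces.linear s2 s2 \<phi>11 \<and>
      \<phi> = block_op \<phi>00 \<phi>01 \<phi>10 \<phi>11)"
    (is "?lin \<longleftrightarrow> ?blocks")
proof
  assume ?lin
  then have add: "\<phi> (u + v) = \<phi> u + \<phi> v"
    and sc: "\<phi> (VP.scale c u) = VP.scale c (\<phi> u)" for u v c
    unfolding Vector_Spaces.linear_iff by blast+
  have "Vector_Spaces.linear s1 s1 (\<lambda>x. fst (\<phi> (x, 0)))"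
      "Vector_Spaces.linear s1 s2 (\<lambda>x. snd (\<phi> (x, 0)))"
    using add[of "(_, 0)" "(_, 0)"] sc[of _ "(_, 0)"]
    by (simp_all add: Vector_Spaces.linear_iff VP.scale_def L1.vector_space_axioms L2.vector_space_axioms)
  moreover have "Vector_Spaces.linear s2 s1 (\<lambda>y. fst (\<phi> (0, y)))"
      "Vector_Spaces.linear s2 s2 (\<lambda>y. snd (\<phi> (0, y)))"
    using add[of "(0, _)" "(0, _)"] sc[of _ "(0, _)"]
    by (simp_all add: Vector_Spaces.linear_iff VP.scale_def L1.vector_space_axioms L2.vector_space_axioms)
  moreover have "\<phi> = block_op (\<lambda>x. fst (\<phi> (x, 0))) (\<lambda>y. fst (\<phi> (0, y)))
      (\<lambda>x. snd (\<phi> (x, 0))) (\<lambda>y. snd (\<phi> (0, y)))"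
  proof
    fix u :: "'a \<times> 'b"
    obtain x y where u: "u = (x, 0) + (0, y)"
      by (rule that[of "fst u" "snd u"]) (simp add: prod_eq_iff)
    show "\<phi> u = block_op (\<lambda>x. fst (\<phi> (x, 0))) (\<lambda>y. fst (\<phi> (0, y)))
        (\<lambda>x. snd (\<phi> (x, 0))) (\<lambda>y. snd (\<phi> (0, y))) u"
      unfolding u add by (simp add: block_op_def prod_eq_iff)
  qed
  ultimately show ?blocks
    by blast
next
  assume ?blocks
  then show ?lin
    by (clarsimp simp: Vector_Spaces.linear_iff block_op_def VP.scale_def VP.p.vector_space_axioms
        L1.scale_right_distrib L2.scale_right_distrib add.assoc add.left_commute)
qed

end

text \<open>The direct sum of an almost Abelian and an Abelian Lie algebra is itself almost Abelian.\<close>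

lemma almost_abelian_prod:
  fixes s1 :: "'f::field \<Rightarrow> 'a::ab_group_add \<Rightarrow> 'a" and s2 :: "'f \<Rightarrow> 'b::ab_group_add \<Rightarrow> 'b"
  assumes "almost_abelian_lie_algebra s1 br1" and "abelian_lie_algebra s2 br2"
  shows "almost_abelian_lie_algebra (module_prod.scale s1 s2) (bracket_prod br1 br2)"
proof -
  interpret L1: almost_abelian_lie_algebra s1 br1 by fact
  interpret L2: abelian_lie_algebra s2 br2 by fact
  interpret lie_algebra_pair s1 br1 s2 br2 ..
  obtain A C where A: "L1.abelian_subalgebra A" "L1.direct_sum_of A C" "L1.dim C = 1"
    using L1.codim_1_abelian by (auto simp: L1.codim_1_def)
  have sub: "L1.subspace A" "L1.subspace C"
    using A by (auto simp: L1.direct_sum_of_def)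
  obtain B where B: "B \<subseteq> C" "L1.independent B" "C \<subseteq> L1.span B" "card B = L1.dim C"
    using L1.basis_exists by blast
  then obtain e where e: "B = {e}" "e \<noteq> 0"
    using A(3) by (metis card_1_singletonE insertI1 L1.dependent_zero)
  have C: "C = L1.span {e}"
    using B e sub(2) by (metis L1.span_minimal subset_antisym)
  have "VP.p.span {(e, 0)} = C \<times> {0}"
    using VP.span_Times_sing2[of "{e}"] C by simp
  then have "VP.p.span {(e, 0)} = VP.p.span (C \<times> {0})"
    by (metis VP.p.span_span)
  moreover have "VP.p.independent {(e, 0)}"
    using e by (simp add: VP.p.dependent_single zero_prod_def)
  ultimately have "VP.p.dim (C \<times> {0}) = 1"
    by (simp add: VP.p.dim_eq_card)
  moreover have "P.direct_sum_of (A \<times> UNIV) (C \<times> {0})"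
  proof -
    have "w \<in> {u + v | u v. u \<in> A \<times> UNIV \<and> v \<in> C \<times> {0}}" for w :: "'a \<times> 'b"
    proof -
      obtain a c where "fst w = a + c" "a \<in> A" "c \<in> C"
        using A(2) unfolding L1.direct_sum_of_def by blast
      then have "w = (a, snd w) + (c, 0)" "(a, snd w) \<in> A \<times> UNIV" "(c, 0) \<in> C \<times> {0}"
        by (auto simp: prod_eq_iff)
      then show ?thesis by blast
    qed
    then have "{u + v | u v. u \<in> A \<times> UNIV \<and> v \<in> C \<times> {0}} = (UNIV :: ('a \<times> 'b) set)"
      by blast
    moreover have "(A \<times> UNIV) \<inter> (C \<times> {0}) = {0 :: 'a \<times> 'b}"
      using A(2) by (auto simp: L1.direct_sum_of_def zero_prod_def)
    ultimately show ?thesis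
      using sub VP.subspace_Times by (auto simp: P.direct_sum_of_def)
  qed
  moreover have "P.abelian_subalgebra (A \<times> UNIV)"
    using A(1) sub L2.abelian VP.subspace_Times[of A UNIV]
    by (auto simp: P.abelian_subalgebra_def P.subalgebra_def P.commuting_def
        L1.abelian_subalgebra_def L1.subalgebra_def L1.commuting_def L2.commuting_def
        bracket_prod_def zero_prod_def)
  moreover have "\<not> P.commuting UNIV UNIV"
    using L1.non_abelian
    by (auto simp: P.commuting_def L1.commuting_def bracket_prod_def zero_prod_def)
  ultimately show ?thesis
    by unfold_locales (auto simp: P.codim_1_def)
qed

end

theory Submission
  imports Defs
begin

text \<open>Since \<open>W\<close> is Abelian, the bracket of \<open>L\<^sub>0 \<oplus> W\<close> only sees the \<open>L\<^sub>0\<close>-component. Hence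
  \<open>\<phi>\<close> is Lie orthogonal if and only if
  \<open>[\<phi>\<^sub>0\<^sub>0 x + \<phi>\<^sub>0\<^sub>1 y, \<phi>\<^sub>0\<^sub>0 x' + \<phi>\<^sub>0\<^sub>1 y'] = [x, x']\<close> holds identically; \<open>\<phi>\<^sub>1\<^sub>0\<close>
  and \<open>\<phi>\<^sub>1\<^sub>1\<close> drop out. Putting \<open>y = y' = 0\<close> shows that \<open>\<phi>\<^sub>0\<^sub>0\<close> is Lie orthogonal on \<open>L\<^sub>0\<close>; putting
  \<open>x' = 0\<close> and \<open>y = 0\<close> shows that every \<open>\<phi>\<^sub>0\<^sub>1 y'\<close> commutes with the whole image of \<open>\<phi>\<^sub>0\<^sub>0\<close>.

  That image need not be all of \<open>L\<^sub>0\<close>, so one more idea is needed to conclude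
  that \<open>\<phi>\<^sub>0\<^sub>1 y'\<close> is central: in an almost Abelian Lie algebra the centralizer of a noncentral
  element is commutative (\<open>centralizer_of_noncentral_commutes\<close>). The image of a Lie orthogonal
  operator is not commutative, because brackets of images reproduce all brackets of \<open>L\<^sub>0\<close>, so it
  lies in no such centralizer (\<open>central_if_commutes_with_orthogonal_image\<close>).\<close>

context lie_algebra
begin

lemma bracket_zero_left [simp]: "bracket 0 x = 0"
  using bracket_add_left[of 0 0 x] by simp

lemma bracket_zero_right [simp]: "bracket x 0 = 0"
  using bracket_add_right[of x 0 0] by simp

lemma bracket_antisym: "bracket x y = - bracket y x"
proof -
  have "bracket (x + y) (x + y) = bracket x x + bracket y x + (bracket x y + bracket y y)"
    by (simp only: bracket_add_left bracket_add_right)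
  then have "bracket y x + bracket x y = 0"
    by (simp add: bracket_self)
  then show ?thesis
    by (simp add: eq_neg_iff_add_eq_0 add.commute)
qed

lemma bracket_eq_0_commute: "bracket x y = 0 \<longleftrightarrow> bracket y x = 0"
  using bracket_antisym[of x y] by simp

text \<open>A line complementary to a hyperplane may be replaced by the line through any vector outside
  the hyperplane: solve the decomposition of that vector for the original generator.\<close>

lemma codim_1_decompose:
  assumes "codim_1 A" "u \<notin> A"
  obtains a c where "a \<in> A" "x = a + c *s u"
proof -
  obtain C where C: "direct_sum_of A C" "dim C = 1"
    using assms(1) by (auto simp: codim_1_def)
  have A: "subspace A"
    using C(1) by (simp add: direct_sum_of_def)
  have sum: "\<exists>a\<in>A. \<exists>v\<in>C. w = a + v" for w
    using C(1) unfolding direct_sum_of_def by blast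
  obtain B where "C \<subseteq> span B" "card B = dim C"
    using basis_exists by blast
  then obtain e where e: "C \<subseteq> span {e}"
    using C(2) by (metis card_1_singletonE)
  have dec: "\<exists>a\<in>A. \<exists>c. w = a + c *s e" for w
  proof -
    obtain a v where "a \<in> A" "v \<in> C" "w = a + v"
      using sum by blast
    moreover obtain c where "v = c *s e"
      using e \<open>v \<in> C\<close> by (auto simp: span_singleton)
    ultimately show ?thesis by blast
  qed
  obtain a1 c1 where u: "a1 \<in> A" "u = a1 + c1 *s e"
    using dec by blast
  have "c1 \<noteq> 0"
    using assms(2) u by auto
  obtain a2 c2 where x: "a2 \<in> A" "x = a2 + c2 *s e"
    using dec by blast
  let ?c = "c2 / c1"
  have "x = (a2 - ?c *s a1) + ?c *s u"
    using \<open>c1 \<noteq> 0\<close> by (simp add: u x scale_right_distrib)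
  moreover have "a2 - ?c *s a1 \<in> A"
    using A u x by (simp add: subspace_diff subspace_scale)
  ultimately show ?thesis
    using that by blast
qed

end

context almost_abelian_lie_algebra
begin

text \<open>Let \<open>A\<close> be an Abelian hyperplane. If \<open>z \<notin> A\<close>, every element is a multiple of \<open>z\<close> plus an
  element of \<open>A\<close>, and only the commuting \<open>A\<close>-parts contribute to \<open>[x, y]\<close>. If \<open>z \<in> A\<close>, nothing
  outside \<open>A\<close> can commute with \<open>z\<close>, since such an element spans the whole algebra together with
  \<open>A\<close> and would make \<open>z\<close> central; hence \<open>x\<close> and \<open>y\<close> both lie in \<open>A\<close>.\<close>

lemma centralizer_of_noncentral_commutes:
  assumes z: "z \<notin> center" and xz: "bracket z x = 0" and yz: "bracket z y = 0"
  shows "bracket x y = 0"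
proof -
  obtain A where A: "codim_1 A" and comm: "\<And>a b. a \<in> A \<Longrightarrow> b \<in> A \<Longrightarrow> bracket a b = 0"
    using codim_1_abelian by (auto simp: abelian_subalgebra_def commuting_def)
  show ?thesis
  proof (cases "z \<in> A")
    case False
    obtain a c where x: "a \<in> A" "x = a + c *s z"
      using codim_1_decompose[OF A False] by blast
    obtain b d where y: "b \<in> A" "y = b + d *s z"
      using codim_1_decompose[OF A False] by blast
    have "bracket z b = 0"
      using yz y by (simp add: bracket_add_right bracket_scale_right bracket_self)
    moreover have "bracket a z = 0"
      using xz x bracket_eq_0_commute[of a z]
      by (simp add: bracket_add_right bracket_scale_right bracket_self)
    ultimately show ?thesis
      using comm[OF x(1) y(1)]
      by (simp add: x(2) y(2) bracket_add_left bracket_add_right bracket_scale_left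
          bracket_scale_right bracket_self)
  next
    case True
    have in_A: "v \<in> A" if v: "bracket z v = 0" for v
    proof (rule ccontr)
      assume "v \<notin> A"
      have "bracket z w = 0" for w
      proof -
        obtain a c where "a \<in> A" "w = a + c *s v"
          using codim_1_decompose[OF A \<open>v \<notin> A\<close>] by blast
        then show ?thesis
          using comm[OF True] v by (simp add: bracket_add_right bracket_scale_right)
      qed
      then show False
        using z by (simp add: center_def)
    qed
    show ?thesis
      using comm in_A xz yz by blast
  qed
qed

lemma central_if_commutes_with_orthogonal_image:
  assumes T: "T \<in> lie_orthogonal" and z: "\<And>x. bracket z (T x) = 0"
  shows "z \<in> center"
proof (rule ccontr)
  assume "z \<notin> center"
  then have "bracket (T x) (T y) = 0" for x y
    using centralizer_of_noncentral_commutes z by blast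
  then have "bracket x y = 0" for x y
    using T by (simp add: lie_orthogonal_def)
  then show False
    using non_abelian by (simp add: commuting_def)
qed

end

theorem proposition16:
  fixes s0 :: "'f::field \<Rightarrow> 'a::ab_group_add \<Rightarrow> 'a" and br0 :: "'a \<Rightarrow> 'a \<Rightarrow> 'a"
    and sW :: "'f \<Rightarrow> 'b::ab_group_add \<Rightarrow> 'b" and brW :: "'b \<Rightarrow> 'b \<Rightarrow> 'b"
  assumes "indecomposable_almost_abelian_lie_algebra s0 br0"
    and "abelian_lie_algebra sW brW"
    and "almost_abelian_lie_algebra (module_prod.scale s0 sW) (bracket_prod br0 brW)"
  shows "lie_algebra.lie_orthogonal (module_prod.scale s0 sW) (bracket_prod br0 brW) =
    {block_op \<phi>00 \<phi>01 \<phi>10 \<phi>11 | \<phi>00 \<phi>01 \<phi>10 \<phi>11.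
      Vector_Spaces.linear s0 s0 \<phi>00 \<and> Vector_Spaces.linear sW s0 \<phi>01 \<and>
      Vector_Spaces.linear s0 sW \<phi>10 \<and> Vector_Spaces.linear sW sW \<phi>11 \<and>
      \<phi>00 \<in> lie_algebra.lie_orthogonal s0 br0 \<and>
      range \<phi>01 \<subseteq> lie_algebra.center br0}"
proof -
  interpret L0: indecomposable_almost_abelian_lie_algebra s0 br0 by fact
  interpret W: abelian_lie_algebra sW brW by fact
  interpret lie_algebra_pair s0 br0 sW brW ..
  have brW: "brW u v = 0" for u v
    using W.abelian by (simp add: W.commuting_def)
  have block_orthogonal_iff:
    "(\<forall>u v. bracket_prod br0 brW (block_op \<phi>00 \<phi>01 \<phi>10 \<phi>11 u) (block_op \<phi>00 \<phi>01 \<phi>10 \<phi>11 v) =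
        bracket_prod br0 brW u v) \<longleftrightarrow>
      \<phi>00 \<in> L0.lie_orthogonal \<and> range \<phi>01 \<subseteq> L0.center"
    (is "?orth \<longleftrightarrow> ?blocks")
    if lin: "Vector_Spaces.linear s0 s0 \<phi>00" "Vector_Spaces.linear sW s0 \<phi>01"
    for \<phi>00 \<phi>01 and \<phi>10 :: "'a \<Rightarrow> 'b" and \<phi>11 :: "'b \<Rightarrow> 'b"
  proof -
    have zero: "\<phi>00 0 = 0" "\<phi>01 0 = 0"
      using lin by (metis Vector_Spaces.linear_iff add_cancel_right_right add.right_neutral)+
    have "?orth \<longleftrightarrow> (\<forall>x y x' y'. br0 (\<phi>00 x + \<phi>01 y) (\<phi>00 x' + \<phi>01 y') = br0 x x')"
      by (simp add: bracket_prod_def block_op_def brW)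
    also have "\<dots> \<longleftrightarrow> ?blocks"
    proof
      assume orth: "\<forall>x y x' y'. br0 (\<phi>00 x + \<phi>01 y) (\<phi>00 x' + \<phi>01 y') = br0 x x'"
      have "br0 (\<phi>00 x) (\<phi>00 x') = br0 x x'" for x x'
        using orth[rule_format, of x 0 x' 0] by (simp add: zero)
      then have T: "\<phi>00 \<in> L0.lie_orthogonal"
        using lin by (simp add: L0.lie_orthogonal_def)
      have "br0 (\<phi>01 y) (\<phi>00 x) = 0" for x y
        using orth[rule_format, of 0 y x 0] by (simp add: zero)
      then show ?blocks
        using L0.central_if_commutes_with_orthogonal_image[OF T] T by blast
    next
      assume blocks: ?blocks
      then have "br0 (\<phi>01 y) x = 0" for x y
        by (auto simp: L0.center_def)
      moreover from this have "br0 x (\<phi>01 y) = 0" for x y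
        using L0.bracket_eq_0_commute by blast
      ultimately show "\<forall>x y x' y'. br0 (\<phi>00 x + \<phi>01 y) (\<phi>00 x' + \<phi>01 y') = br0 x x'"
        using blocks
        by (simp add: L0.bracket_add_left L0.bracket_add_right L0.lie_orthogonal_def)
    qed
    finally show ?thesis .
  qed
  show ?thesis
    unfolding P.lie_orthogonal_def linear_block_op_iff
    using block_orthogonal_iff by blast
qed

end
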